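(* Let $k>0$. Then: 1. The function $g_k$ defined (for real parameters $u,v$ with $u^2+v^2<\frac1k$) by $$g_k(t)=\frac{1}{\sqrt{k}}\arccos\Big(\sqrt{k}\,\big[u\cos(\sqrt{k}\,t)+v\sin(\sqrt{k}\,t)\big]\Big)$$ satisfies the differential equation $$g_k''=\sqrt{k}\,\big(1-(g_k')^2\big)\cot(\sqrt{k}\,g_k).$$ 2. Let $0\le a<b$ and let $g:[a,b]\to\mathbb{R}$ be a smooth (or of class $\mathcal{C}^2$), positive-valued, distance-like function. Assume that $b$ and $\max_{a\le t\le b}g(t)$ are small enough, depending on $k$, to make the triangles with edge lengths $t_2-t_1$, $g(t_1)$, $g(t_2)$ (for $a\le t_1<t_2\le b$) embeddable into the sphere of radius $\frac{1}{\sqrt{k}}$ with its intrinsic metric, and small enough to make the values $\cos(\sqrt{k}\,t)$ and $\sin(\sqrt{k}\,g(t))$ positive for $t\in[a,b]$. For $a\le t_1<t_2\le b$ let $g_k^{t_1,t_2}$ denote the function $g_k$ with parameter values adjusted so that $g_k^{t_1,t_2}(t_1)=g(t_1)$ and $g_k^{t_1,t_2}(t_2)=g(t_2)$. (i) The differential inequality $$g''\ge\sqrt{k}\,\big(1-(g')^2\big)\cot(\sqrt{k}\,g)$$ is satisfied on $[a,b]$ if and only if $g\le g_k^{t_1,t_2}$ holds on $[t_1,t_2]$ for any $a\le t_1<t_2\le b$. (ii) The differential inequality $$g''\le\sqrt{k}\,\big(1-(g')^2\big)\cot(\sqrt{k}\,g)$$ is satisfied on $[a,b]$ if and only if $g\ge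 g_k^{t_1,t_2}$ holds on $[t_1,t_2]$ for any $a\le t_1<t_2\le b$.
   Context: A non-negative function $g:[a,b]\to\mathbb{R}$ is called distance-like if it is nonexpanding, i.e. $|g(t_1)-g(t_2)|\le|t_1-t_2|$ for all $t_1,t_2\in[a,b]$, and moreover $|t_1-t_2|\le g(t_1)+g(t_2)$ for all $t_1,t_2\in[a,b]$. Here $\arccos:[-1,1]\to[0,\pi]$. For $k>0$, the function $g_k$ with real parameters $u,v$, restricted throughout by $u^2+v^2<\frac1k$, is the intrinsic distance, in the sphere of radius $\frac{1}{\sqrt{k}}$ centered at the origin of $\mathbb{R}^3$, from the point $\big(u,v,\sqrt{\tfrac1k-u^2-v^2}\big)$ to the point $\big(\tfrac{1}{\sqrt{k}}\cos\sqrt{k}\,t,\tfrac{1}{\sqrt{k}}\sin\sqrt{k}\,t,0\big)$. The function $g_k^{t_1,t_2}$ is the function $g_k$ whose parameters $u,v$ are adjusted to the values of $g$ at $t_1$ and $t_2$; for $k>0$, $b$ and $\max_{a\le t\le b}g(t)$ must be small enough for this to be possible. *)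

theory Defs
  imports "HOL-Analysis.Analysis"
begin

section \<open>Distance-like functions\<close>

definition distance_like_on :: "real \<Rightarrow> real \<Rightarrow> (real \<Rightarrow> real) \<Rightarrow> bool" where
  "distance_like_on a b g \<longleftrightarrow>
     (\<forall>t\<in>{a..b}. 0 \<le> g t) \<and>
     (\<forall>t1\<in>{a..b}. \<forall>t2\<in>{a..b}. \<bar>g t1 - g t2\<bar> \<le> \<bar>t1 - t2\<bar>) \<and>
     (\<forall>t1\<in>{a..b}. \<forall>t2\<in>{a..b}. \<bar>t1 - t2\<bar> \<le> g t1 + g t2)"

text \<open>Derivatives are taken within \<open>S\<close>, so they are one-sided at the end points of a
  compact interval.\<close>

definition has_first_second_deriv_on ::
  "(real \<Rightarrow> real) \<Rightarrow> (real \<Rightarrow> real) \<Rightarrow> (real \<Rightarrow> real) \<Rightarrow> real set \<Rightarrow> bool" where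
  "has_first_second_deriv_on f f' f'' S \<longleftrightarrow>
     (\<forall>t\<in>S. (f has_real_derivative f' t) (at t within S) \<and>
            (f' has_real_derivative f'' t) (at t within S))"

section \<open>Intrinsic metric and embeddable triangles\<close>

definition curve_length :: "(real \<Rightarrow> 'a::metric_space) \<Rightarrow> ereal" where
  "curve_length \<gamma> =
     Sup {ereal (\<Sum>i<n. dist (\<gamma> (p i)) (\<gamma> (p (Suc i)))) | (n::nat) p.
            mono p \<and> range p \<subseteq> {0..1}}"

definition intrinsic_dist :: "'a::metric_space set \<Rightarrow> 'a \<Rightarrow> 'a \<Rightarrow> ereal" where
  "intrinsic_dist S x y =
     Inf {curve_length \<gamma> | \<gamma>.
            path \<gamma> \<and> path_image \<gamma> \<subseteq> S \<and> pathstart \<gamma> = x \<and> pathfinish \<gamma> = y}"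

definition triangle_embeddable :: "real \<Rightarrow> real \<Rightarrow> real \<Rightarrow> real \<Rightarrow> bool" where
  "triangle_embeddable k l l1 l2 \<longleftrightarrow>
     (let S = sphere (0 :: real ^ 3) (1 / sqrt k) in
      \<exists>P\<in>S. \<exists>Q\<in>S. \<exists>R\<in>S.
        intrinsic_dist S P Q = ereal l \<and>
        intrinsic_dist S P R = ereal l1 \<and>
        intrinsic_dist S Q R = ereal l2)"

section \<open>The comparison functions\<close>

definition gk :: "real \<Rightarrow> real \<Rightarrow> real \<Rightarrow> real \<Rightarrow> real" where
  "gk k u v t =
     1 / sqrt k * arccos (sqrt k * (u * cos (sqrt k * t) + v * sin (sqrt k * t)))"

definition adjusted :: "real \<Rightarrow> (real \<Rightarrow> real) \<Rightarrow> real \<Rightarrow> real \<Rightarrow> real \<Rightarrow> real \<Rightarrow> bool" where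
  "adjusted k g t1 t2 u v \<longleftrightarrow>
     u\<^sup>2 + v\<^sup>2 < 1 / k \<and> gk k u v t1 = g t1 \<and> gk k u v t2 = g t2"

text \<open>The function \<open>g\<^sub>k\<close> with parameters adjusted to \<open>g\<close> at \<open>t1\<close> and \<open>t2\<close> is \<open>gk k u v\<close> for the
  pair \<open>(u, v)\<close> with \<open>adjusted k g t1 t2 u v\<close>. This pair exists and is unique whenever the
  spherical triangle is nondegenerate, i.e. its vertices are not on a common great circle. For a
  degenerate triangle the parameters would have to satisfy \<open>u\<^sup>2 + v\<^sup>2 = 1 / k\<close>, which is
  excluded.\<close>

lemma gk_eq_iff:
  assumes k: "0 < k" and uv: "u\<^sup>2 + v\<^sup>2 < 1 / k"
    and c: "0 \<le> c" "c \<le> pi / sqrt k"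
  shows "gk k u v t = c \<longleftrightarrow>
    sqrt k * (u * cos (sqrt k * t) + v * sin (sqrt k * t)) = cos (sqrt k * c)"
proof -
  define w where "w = sqrt k * (u * cos (sqrt k * t) + v * sin (sqrt k * t))"
  have s: "sqrt k > 0" using k by simp
  have "(u * cos (sqrt k * t) + v * sin (sqrt k * t))\<^sup>2
      + (u * sin (sqrt k * t) - v * cos (sqrt k * t))\<^sup>2
      = (u\<^sup>2 + v\<^sup>2) * ((cos (sqrt k * t))\<^sup>2 + (sin (sqrt k * t))\<^sup>2)"
    by algebra
  then have "(u * cos (sqrt k * t) + v * sin (sqrt k * t))\<^sup>2 \<le> u\<^sup>2 + v\<^sup>2"
    using zero_le_power2[of "u * sin (sqrt k * t) - v * cos (sqrt k * t)"]
    by (simp only: sin_cos_squared_add2 mult_1_right)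
  then have "k * (u * cos (sqrt k * t) + v * sin (sqrt k * t))\<^sup>2 \<le> k * (1 / k)"
    using uv k by (intro mult_left_mono) auto
  then have "w\<^sup>2 \<le> 1"
    using k by (simp add: w_def power_mult_distrib)
  then have w: "\<bar>w\<bar> \<le> 1"
    by (simp add: abs_square_le_1)
  have sc: "0 \<le> sqrt k * c" "sqrt k * c \<le> pi"
    using c s by (simp_all add: field_simps)
  have "gk k u v t = c \<longleftrightarrow> arccos w = sqrt k * c"
    using s by (auto simp: gk_def w_def field_simps)
  also have "\<dots> \<longleftrightarrow> w = cos (sqrt k * c)"
    using w sc by (metis arccos_cos cos_arccos_abs)
  finally show ?thesis by (simp add: w_def)
qed

lemma adjusted_ex1:
  assumes k: "0 < k"
    and tri: "\<bar>g t1 - g t2\<bar> < t2 - t1" "t2 - t1 < g t1 + g t2"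
    and perimeter: "g t1 + g t2 + (t2 - t1) < 2 * pi / sqrt k"
  shows "\<exists>!(u, v). adjusted k g t1 t2 u v"
proof -
  define s where "s = sqrt k"
  define x y where "x = s * t1" and "y = s * t2"
  define A B where "A = s * g t1" and "B = s * g t2"
  have s: "s > 0" and ss: "s * s = k" using k by (auto simp: s_def)
  have 1: "\<bar>A - B\<bar> < y - x"
    using mult_strict_left_mono[OF tri(1) s] s
    by (simp add: A_def B_def x_def y_def flip: right_diff_distrib) (simp add: abs_mult)
  have 2: "y - x < A + B"
    using mult_strict_left_mono[OF tri(2) s]
    by (simp add: A_def B_def x_def y_def algebra_simps)
  have 3: "A + B + (y - x) < 2 * pi"
    using mult_strict_left_mono[OF perimeter s] s
    by (simp add: A_def B_def x_def y_def algebra_simps s_def)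
  have A: "0 < A" "A < pi" and B: "0 < B" "B < pi" and d: "0 < y - x" "y - x < pi"
    using 1 2 3 by linarith+
  have gA: "0 \<le> g t1" "g t1 \<le> pi / sqrt k" and gB: "0 \<le> g t2" "g t2 \<le> pi / sqrt k"
    using A B s by (auto simp: A_def B_def s_def field_simps zero_less_mult_iff)
  define D where "D = sin (y - x)"
  have D: "D > 0" using d by (simp add: D_def sin_gt_zero)
  have Dxy: "D = sin y * cos x - cos y * sin x" by (simp add: D_def sin_diff)
  have adj: "adjusted k g t1 t2 u v \<longleftrightarrow> u\<^sup>2 + v\<^sup>2 < 1 / k \<and>
      s * (u * cos x + v * sin x) = cos A \<and> s * (u * cos y + v * sin y) = cos B" for u v
    using gk_eq_iff[OF k _ gA, of u v t1] gk_eq_iff[OF k _ gB, of u v t2]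
    by (auto simp: adjusted_def A_def B_def x_def y_def s_def)
  have lin: "s * (u * cos x + v * sin x) = cos A \<and> s * (u * cos y + v * sin y) = cos B \<longleftrightarrow>
      s * D * u = cos A * sin y - cos B * sin x \<and> s * D * v = cos B * cos x - cos A * cos y"
    for u v
  proof
    assume *: "s * (u * cos x + v * sin x) = cos A \<and> s * (u * cos y + v * sin y) = cos B"
    then show "s * D * u = cos A * sin y - cos B * sin x \<and> s * D * v = cos B * cos x - cos A * cos y"
      unfolding Dxy by (simp flip: conjunct1[OF *] conjunct2[OF *] add: algebra_simps)
  next
    assume *: "s * D * u = cos A * sin y - cos B * sin x \<and> s * D * v = cos B * cos x - cos A * cos y"
    have "D * (s * (u * cos x + v * sin x)) = (s * D * u) * cos x + (s * D * v) * sin x"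
      by (simp add: algebra_simps)
    also have "\<dots> = D * cos A" unfolding conjunct1[OF *] conjunct2[OF *] unfolding Dxy
      by (simp add: algebra_simps)
    finally have 1: "s * (u * cos x + v * sin x) = cos A" using D by simp
    have "D * (s * (u * cos y + v * sin y)) = (s * D * u) * cos y + (s * D * v) * sin y"
      by (simp add: algebra_simps)
    also have "\<dots> = D * cos B" unfolding conjunct1[OF *] conjunct2[OF *] unfolding Dxy
      by (simp add: algebra_simps)
    finally have "s * (u * cos y + v * sin y) = cos B" using D by simp
    with 1 show "s * (u * cos x + v * sin x) = cos A \<and> s * (u * cos y + v * sin y) = cos B" ..
  qed
  define u v where "u = (cos A * sin y - cos B * sin x) / (s * D)"
    and "v = (cos B * cos x - cos A * cos y) / (s * D)"
  have uv: "s * D * u = cos A * sin y - cos B * sin x" "s * D * v = cos B * cos x - cos A * cos y"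
    using s D by (auto simp: u_def v_def)
  have "(cos A * sin y - cos B * sin x)\<^sup>2 + (cos B * cos x - cos A * cos y)\<^sup>2
      = (cos A)\<^sup>2 * ((sin y)\<^sup>2 + (cos y)\<^sup>2) + (cos B)\<^sup>2 * ((sin x)\<^sup>2 + (cos x)\<^sup>2)
        - 2 * cos A * cos B * (cos y * cos x + sin y * sin x)"
    by algebra
  also have "\<dots> = (cos A)\<^sup>2 + (cos B)\<^sup>2 - 2 * cos A * cos B * cos (y - x)"
    by (simp add: cos_diff)
  finally have gram: "(s * D * u)\<^sup>2 + (s * D * v)\<^sup>2
      = (cos A)\<^sup>2 + (cos B)\<^sup>2 - 2 * cos A * cos B * cos (y - x)"
    by (simp only: uv)
  have c1: "cos (y - x) < cos (A - B)"
  proof -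
    have "cos (y - x) < cos \<bar>A - B\<bar>"
      using 1 d by (intro cos_monotone_0_pi) auto
    then show ?thesis by simp
  qed
  have c2: "cos (A + B) < cos (y - x)"
  proof (cases "A + B \<le> pi")
    case True
    then show ?thesis using 2 d by (intro cos_monotone_0_pi) auto
  next
    case False
    then have "cos (2 * pi - (A + B)) < cos (y - x)"
      using 3 d by (intro cos_monotone_0_pi) auto
    moreover have "cos (2 * pi - (A + B)) = cos (A + B)"
      by (metis cos_2pi_minus)
    ultimately show ?thesis by simp
  qed
  have "0 < (cos (A - B) - cos (y - x)) * (cos (y - x) - cos (A + B))"
    using c1 c2 by simp
  also have "\<dots> = 1 - (cos (y - x))\<^sup>2 - ((cos A)\<^sup>2 + (cos B)\<^sup>2 - 2 * cos A * cos B * cos (y - x))"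
    using sin_cos_squared_add[of A] sin_cos_squared_add[of B]
    unfolding cos_diff[of A B] cos_add[of A B] by algebra
  finally have "(s * D * u)\<^sup>2 + (s * D * v)\<^sup>2 < D\<^sup>2"
    unfolding gram by (simp add: D_def sin_squared_eq)
  then have "D\<^sup>2 * (k * (u\<^sup>2 + v\<^sup>2)) < D\<^sup>2 * 1"
    by (simp add: power2_eq_square algebra_simps flip: ss)
  then have "k * (u\<^sup>2 + v\<^sup>2) < 1"
    using D by (subst (asm) mult_less_cancel_left_pos) auto
  then have "u\<^sup>2 + v\<^sup>2 < 1 / k"
    using k by (simp add: field_simps)
  then have ex: "adjusted k g t1 t2 u v"
    using adj lin uv by blast
  have "u' = u \<and> v' = v" if "adjusted k g t1 t2 u' v'" for u' v'
  proof -
    have "s * D * u' = s * D * u" "s * D * v' = s * D * v"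
      using that adj lin uv by metis+
    then show ?thesis using s D by simp
  qed
  with ex show ?thesis by (auto intro!: ex1I[of _ "(u, v)"])
qed

end

theory Submission
  imports Defs
begin

text \<open>With \<open>f = cos (sqrt k * g)\<close>, the quantity \<open>f'' + k * f\<close> equals
  \<open>- sqrt k * sin (sqrt k * g)\<close> times the difference of the two sides of the differential
  inequality, whereas \<open>h = cos (sqrt k * g\<^sub>k)\<close> solves \<open>h'' + k * h = 0\<close>. So both directions are
  statements about \<open>w = f - h\<close>, which vanishes at \<open>t\<^sub>1\<close> and \<open>t\<^sub>2\<close>. Where \<open>c = cos (sqrt k * t)\<close> is
  positive, \<open>(c\<^sup>2 * (w / c)')' = c * (w'' + k * w)\<close>, which yields a maximum principle.
  Conversely, where the differential inequality fails, \<open>g\<close> is nowhere of slope \<open>1\<close> or \<open>-1\<close> on a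
  whole interval, so short triangles there are nondegenerate and comparison functions exist.
  Embeddability of the triangles is used only through \<open>sqrt k * g \<le> pi\<close>, since \<open>pi / sqrt k\<close>
  is the intrinsic diameter of the sphere.\<close>

section \<open>The diameter of the sphere\<close>

lemma curve_length_lipschitz:
  assumes "\<And>x y. dist (\<gamma> x) (\<gamma> y) \<le> L * \<bar>x - y\<bar>" "0 \<le> L"
  shows "curve_length \<gamma> \<le> ereal L"
  unfolding curve_length_def
proof (rule Sup_least, clarify)
  fix n :: nat and p :: "nat \<Rightarrow> real"
  assume p: "mono p" "range p \<subseteq> {0..1}"
  have "(\<Sum>i<n. dist (\<gamma> (p i)) (\<gamma> (p (Suc i)))) \<le> (\<Sum>i<n. L * (p (Suc i) - p i))"
  proof (rule sum_mono)
    fix i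
    have "p i \<le> p (Suc i)" using p(1) by (simp add: mono_def)
    then show "dist (\<gamma> (p i)) (\<gamma> (p (Suc i))) \<le> L * (p (Suc i) - p i)"
      using assms(1)[of "p i" "p (Suc i)"] by simp
  qed
  also have "\<dots> = L * (p n - p 0)"
    by (simp add: sum_distrib_left[symmetric] sum_lessThan_telescope)
  also have "\<dots> \<le> L * 1"
  proof (rule mult_left_mono)
    have "p n \<in> {0..1}" "p 0 \<in> {0..1}" using p(2) by blast+
    then show "p n - p 0 \<le> 1" by simp
  qed (fact assms(2))
  finally show "ereal (\<Sum>i<n. dist (\<gamma> (p i)) (\<gamma> (p (Suc i)))) \<le> ereal L" by simp
qed

text \<open>Gram-Schmidt: \<open>z\<close> is the part of \<open>Q\<close> orthogonal to
  \<open>P\<close> and has norm \<open>sin \<theta> * r\<close>, so rescaling it gives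
  \<open>e\<close>. If \<open>Q\<close> is \<open>P\<close> or \<open>- P\<close>, then
  \<open>z\<close> vanishes, and the dimension bound supplies some orthogonal direction.\<close>

lemma sphere_great_circle:
  fixes P Q :: "'a::euclidean_space"
  assumes "2 \<le> DIM('a)" and r: "0 < r" and P: "P \<in> sphere 0 r" and Q: "Q \<in> sphere 0 r"
  obtains e \<theta> where "norm e = r" "orthogonal P e" "0 \<le> \<theta>" "\<theta> \<le> pi"
    "Q = cos \<theta> *\<^sub>R P + sin \<theta> *\<^sub>R e"
proof -
  have nP: "norm P = r" and nQ: "norm Q = r" using P Q by auto
  have PP: "P \<bullet> P = r\<^sup>2" and QQ: "Q \<bullet> Q = r\<^sup>2"
    using nP nQ by (simp_all add: dot_square_norm)
  define c where "c = (P \<bullet> Q) / r\<^sup>2"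
  have cPQ: "P \<bullet> Q = c * r\<^sup>2" using r by (simp add: c_def)
  define z where "z = Q - c *\<^sub>R P"
  have Pz: "P \<bullet> z = 0" by (simp add: z_def inner_diff_right cPQ PP)
  have zz: "z \<bullet> z = (1 - c\<^sup>2) * r\<^sup>2"
    by (simp add: z_def inner_diff_right inner_diff_left cPQ PP QQ inner_commute[of Q P]
        power2_eq_square algebra_simps)
  then have "0 \<le> (1 - c\<^sup>2) * r\<^sup>2" by (metis inner_ge_zero)
  then have c: "c\<^sup>2 \<le> 1" using r by (simp add: zero_le_mult_iff)
  then have c': "-1 \<le> c" "c \<le> 1" by (auto simp: abs_square_le_1 abs_le_iff)
  define \<theta> where "\<theta> = arccos c"
  have \<theta>: "0 \<le> \<theta>" "\<theta> \<le> pi" "cos \<theta> = c" "sin \<theta> = sqrt (1 - c\<^sup>2)"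
    using c c' by (auto simp: \<theta>_def arccos_lbound arccos_ubound sin_arccos)
  have nz: "norm z = sin \<theta> * r"
    using zz r by (simp add: norm_eq_sqrt_inner \<theta>(4) real_sqrt_mult)
  show thesis
  proof (cases "z = 0")
    case False
    then have s: "sin \<theta> \<noteq> 0" using nz by auto
    then have s': "sin \<theta> > 0" using sin_ge_zero[OF \<theta>(1,2)] by linarith
    show thesis
    proof (rule that[of "(1 / sin \<theta>) *\<^sub>R z" \<theta>])
      show "norm ((1 / sin \<theta>) *\<^sub>R z) = r" using nz s' by simp
      show "orthogonal P ((1 / sin \<theta>) *\<^sub>R z)" using Pz by (simp add: orthogonal_def)
      show "Q = cos \<theta> *\<^sub>R P + sin \<theta> *\<^sub>R (1 / sin \<theta>) *\<^sub>R z"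
        using s by (simp add: \<theta>(3) z_def)
    qed (use \<theta> in auto)
  next
    case True
    then have s: "sin \<theta> = 0" using nz r by simp
    obtain y where y: "y \<noteq> 0" "orthogonal P y"
      using orthogonal_to_vector_exists[OF assms(1)] by blast
    show thesis
    proof (rule that[of "(r / norm y) *\<^sub>R y" \<theta>])
      show "norm ((r / norm y) *\<^sub>R y) = r" using y r by simp
      show "orthogonal P ((r / norm y) *\<^sub>R y)" using y by (simp add: orthogonal_def)
      show "Q = cos \<theta> *\<^sub>R P + sin \<theta> *\<^sub>R (r / norm y) *\<^sub>R y"
        using s True by (simp add: \<theta>(3) z_def)
    qed (use \<theta> in auto)
  qed
qed

lemma norm_orthogonal_combination:
  fixes P e :: "'a::real_inner"
  assumes "norm P = r" "norm e = r" "orthogonal P e"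
  shows "(norm (x *\<^sub>R P + y *\<^sub>R e))\<^sup>2 = r\<^sup>2 * (x\<^sup>2 + y\<^sup>2)"
  using assms
  by (subst norm_add_Pythagorean)
     (auto simp: orthogonal_clauses power_mult_distrib algebra_simps)

text \<open>A great-circle arc of angle \<open>\<theta> \<le> pi\<close> joins the points. Every
  chord is at most as long as its arc, so the arc is a Lipschitz curve with constant
  \<open>r * \<theta>\<close>.\<close>

lemma intrinsic_dist_sphere_le:
  fixes P Q :: "'a::euclidean_space"
  assumes "2 \<le> DIM('a)" and r: "0 < r" and P: "P \<in> sphere 0 r" and Q: "Q \<in> sphere 0 r"
  shows "intrinsic_dist (sphere 0 r) P Q \<le> ereal (pi * r)"
proof -
  obtain e \<theta> where e: "norm e = r" "orthogonal P e" and \<theta>: "0 \<le> \<theta>" "\<theta> \<le> pi"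
    and Qe: "Q = cos \<theta> *\<^sub>R P + sin \<theta> *\<^sub>R e"
    using sphere_great_circle[OF assms] by blast
  have nP: "norm P = r" using P by simp
  define \<gamma> where "\<gamma> x = cos (\<theta> * x) *\<^sub>R P + sin (\<theta> * x) *\<^sub>R e" for x
  have norm_\<gamma>: "norm (\<gamma> x) = r" for x
  proof -
    have "(norm (\<gamma> x))\<^sup>2 = r\<^sup>2"
      unfolding \<gamma>_def norm_orthogonal_combination[OF nP e] by simp
    then show ?thesis using r by simp
  qed
  have "path \<gamma>" unfolding path_def \<gamma>_def by (intro continuous_intros)
  have "dist (\<gamma> x) (\<gamma> y) \<le> (r * \<theta>) * \<bar>x - y\<bar>" for x y
  proof -
    have "\<gamma> x - \<gamma> y = (cos (\<theta> * x) - cos (\<theta> * y)) *\<^sub>R P + (sin (\<theta> * x) - sin (\<theta> * y)) *\<^sub>R e"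
      by (simp add: \<gamma>_def algebra_simps)
    then have "(dist (\<gamma> x) (\<gamma> y))\<^sup>2
        = r\<^sup>2 * ((cos (\<theta> * x) - cos (\<theta> * y))\<^sup>2 + (sin (\<theta> * x) - sin (\<theta> * y))\<^sup>2)"
      by (simp add: dist_norm norm_orthogonal_combination[OF nP e])
    also have "(cos (\<theta> * x) - cos (\<theta> * y))\<^sup>2 + (sin (\<theta> * x) - sin (\<theta> * y))\<^sup>2
        = 2 - 2 * cos (\<theta> * x - \<theta> * y)"
      using sin_cos_squared_add[of "\<theta> * x"] sin_cos_squared_add[of "\<theta> * y"]
      unfolding cos_diff by algebra
    \<comment> \<open>The half-angle form makes the squared chord a perfect square.\<close>
    also have "cos (\<theta> * x - \<theta> * y) = 1 - 2 * (sin ((\<theta> * x - \<theta> * y) / 2))\<^sup>2"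
      using cos_double_sin[of "(\<theta> * x - \<theta> * y) / 2"] by (simp only: field_sum_of_halves mult_2)
    finally have "(dist (\<gamma> x) (\<gamma> y))\<^sup>2 = (2 * r * \<bar>sin ((\<theta> * x - \<theta> * y) / 2)\<bar>)\<^sup>2"
      by (simp add: power_mult_distrib)
    then have "dist (\<gamma> x) (\<gamma> y) = 2 * r * \<bar>sin ((\<theta> * x - \<theta> * y) / 2)\<bar>"
      using r by (simp add: power2_eq_iff_nonneg)
    also have "\<dots> \<le> 2 * r * \<bar>(\<theta> * x - \<theta> * y) / 2\<bar>"
      using r by (intro mult_left_mono abs_sin_x_le_abs_x) auto
    also have "\<dots> = (r * \<theta>) * \<bar>x - y\<bar>"
      using \<theta> by (simp add: abs_mult flip: right_diff_distrib)
    finally show ?thesis .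
  qed
  then have "curve_length \<gamma> \<le> ereal (r * \<theta>)"
    using r \<theta> by (intro curve_length_lipschitz) auto
  also have "\<dots> \<le> ereal (pi * r)" using r \<theta> by (simp add: mult.commute)
  finally have "curve_length \<gamma> \<le> ereal (pi * r)" .
  moreover have "intrinsic_dist (sphere 0 r) P Q \<le> curve_length \<gamma>"
    unfolding intrinsic_dist_def
  proof (rule Inf_lower, clarify, intro exI conjI)
    show "path_image \<gamma> \<subseteq> sphere 0 r" by (auto simp: path_image_def norm_\<gamma>)
    show "pathstart \<gamma> = P" by (simp add: pathstart_def \<gamma>_def)
    show "pathfinish \<gamma> = Q" by (simp add: pathfinish_def \<gamma>_def Qe)
  qed (use \<open>path \<gamma>\<close> in auto)
  ultimately show ?thesis by (rule order_trans[rotated])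
qed

lemma triangle_embeddable_le:
  assumes "0 < k" "triangle_embeddable k l l1 l2"
  shows "l1 \<le> pi / sqrt k" "l2 \<le> pi / sqrt k"
proof -
  obtain P Q R :: "real ^ 3"
    where "P \<in> sphere 0 (1 / sqrt k)" "Q \<in> sphere 0 (1 / sqrt k)" "R \<in> sphere 0 (1 / sqrt k)"
      "intrinsic_dist (sphere 0 (1 / sqrt k)) P R = ereal l1"
      "intrinsic_dist (sphere 0 (1 / sqrt k)) Q R = ereal l2"
    using assms(2) unfolding triangle_embeddable_def Let_def by blast
  then show "l1 \<le> pi / sqrt k" "l2 \<le> pi / sqrt k"
    using assms(1) intrinsic_dist_sphere_le[of "1 / sqrt k" P R]
      intrinsic_dist_sphere_le[of "1 / sqrt k" Q R] by auto
qed

section \<open>The comparison functions\<close>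

text \<open>This is \<open>k\<close> times the inner product of the two points of the sphere whose
  distance is \<open>gk\<close>, hence the cosine of \<open>sqrt k * gk\<close> for admissible
  \<open>u\<close>, \<open>v\<close>. Unlike \<open>gk\<close>, it solves a linear equation.\<close>

definition cos_gk :: "real \<Rightarrow> real \<Rightarrow> real \<Rightarrow> real \<Rightarrow> real" where
  "cos_gk k u v t = sqrt k * (u * cos (sqrt k * t) + v * sin (sqrt k * t))"

definition cos_gk_deriv :: "real \<Rightarrow> real \<Rightarrow> real \<Rightarrow> real \<Rightarrow> real" where
  "cos_gk_deriv k u v t = k * (v * cos (sqrt k * t) - u * sin (sqrt k * t))"

lemma gk_conv_cos_gk: "gk k u v t = arccos (cos_gk k u v t) / sqrt k"
  by (simp add: gk_def cos_gk_def)

lemma cos_gk_has_derivs: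
  assumes "0 < k"
  shows "(cos_gk k u v has_real_derivative cos_gk_deriv k u v t) (at t within S)"
    and "(cos_gk_deriv k u v has_real_derivative - k * cos_gk k u v t) (at t within S)"
proof -
  define s where "s = sqrt k"
  have ss: "k = s * s" using assms by (simp add: s_def)
  show "(cos_gk k u v has_real_derivative cos_gk_deriv k u v t) (at t within S)"
    "(cos_gk_deriv k u v has_real_derivative - k * cos_gk k u v t) (at t within S)"
    unfolding cos_gk_def[abs_def] cos_gk_deriv_def[abs_def] s_def[symmetric] unfolding ss
    by (auto intro!: derivative_eq_intros simp: algebra_simps)
qed

text \<open>An orthogonal map takes \<open>(u, v)\<close> to the two combinations below, so neither
  square exceeds \<open>u\<^sup>2 + v\<^sup>2\<close>. The strict bound keeps \<open>arccos\<close>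
  where it is differentiable.\<close>

lemma abs_cos_gk_less_1:
  assumes "0 < k" "u\<^sup>2 + v\<^sup>2 < 1 / k"
  shows "\<bar>cos_gk k u v t\<bar> < 1"
proof -
  have "(u * cos (sqrt k * t) + v * sin (sqrt k * t))\<^sup>2
      + (u * sin (sqrt k * t) - v * cos (sqrt k * t))\<^sup>2
      = (u\<^sup>2 + v\<^sup>2) * ((cos (sqrt k * t))\<^sup>2 + (sin (sqrt k * t))\<^sup>2)"
    by algebra
  then have "(u * cos (sqrt k * t) + v * sin (sqrt k * t))\<^sup>2 \<le> u\<^sup>2 + v\<^sup>2"
    using zero_le_power2[of "u * sin (sqrt k * t) - v * cos (sqrt k * t)"]
    by (simp only: sin_cos_squared_add2 mult_1_right)
  also have "\<dots> < 1 / k" by (fact assms(2))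
  finally have "(cos_gk k u v t)\<^sup>2 < 1"
    using assms(1) by (simp add: cos_gk_def power_mult_distrib pos_less_divide_eq mult.commute)
  then show ?thesis by (simp add: abs_square_less_1)
qed

lemma gk_differential_equation:
  assumes k: "0 < k" and uv: "u\<^sup>2 + v\<^sup>2 < 1 / k"
  shows "\<exists>gk' gk''. has_first_second_deriv_on (gk k u v) gk' gk'' UNIV \<and>
    (\<forall>t. gk'' t = sqrt k * (1 - (gk' t)\<^sup>2) * cot (sqrt k * gk k u v t))"
proof -
  define s where "s = sqrt k"
  have s: "s > 0" and ss: "k = s * s" using k by (auto simp: s_def)
  let ?h = "cos_gk k u v" and ?h' = "cos_gk_deriv k u v"
  \<comment> \<open>\<open>R\<close> is the sine of \<open>sqrt k * gk\<close>, so the cotangent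
    becomes \<open>?h / R\<close>.\<close>
  define R where "R t = sqrt (1 - (?h t)\<^sup>2)" for t
  have h: "-1 < ?h t" "?h t < 1" "(?h t)\<^sup>2 < 1" for t
    using abs_cos_gk_less_1[OF k uv, of t] by (auto simp: abs_less_iff abs_square_less_1)
  have R: "R t > 0" and RR: "(R t)\<^sup>2 = 1 - (?h t)\<^sup>2" for t
    using h(3)[of t] by (auto simp: R_def)
  define G where "G t = - ?h' t / (s * R t)" for t
  define G' where "G' t = s * (1 - (G t)\<^sup>2) * cot (s * gk k u v t)" for t
  have R': "(R has_real_derivative - (?h t * ?h' t) / R t) (at t)" for t
    unfolding R_def[abs_def] using h(3)[of t]
    by (auto intro!: derivative_eq_intros cos_gk_has_derivs[OF k] simp: field_simps)
  have "(gk k u v has_real_derivative G t) (at t)" for t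
    unfolding gk_conv_cos_gk[abs_def] using h[of t] s R[of t]
    by (auto intro!: derivative_eq_intros cos_gk_has_derivs[OF k]
        simp: G_def R_def s_def field_simps)
  moreover have "(G has_real_derivative G' t) (at t)" for t
  proof -
    have cot: "cot (s * gk k u v t) = ?h t / R t"
      using s h[of t] by (simp add: gk_conv_cos_gk s_def[symmetric] cot_def sin_arccos R_def)
    have "(G has_real_derivative
        (- (- k * ?h t) * (s * R t) - (- ?h' t) * (s * (- (?h t * ?h' t) / R t))) /
        (s * R t * (s * R t))) (at t)"
      unfolding G_def[abs_def] using R[of t] s
      by (intro DERIV_divide DERIV_minus DERIV_cmult cos_gk_has_derivs[OF k] R') auto
    \<comment> \<open>With \<open>h = ?h t\<close>, \<open>h' = ?h' t\<close> and
      \<open>R = R t\<close>, the quotient is \<open>h * (k * R^2 - h'^2) / (s * R^3)\<close>;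
      taking out \<open>s * h / R\<close> leaves \<open>1 - (G t)^2\<close>.\<close>
    also have "(- (- k * ?h t) * (s * R t) - (- ?h' t) * (s * (- (?h t * ?h' t) / R t))) /
        (s * R t * (s * R t)) = G' t"
      unfolding G'_def cot G_def using R[of t] s
      by (simp add: ss field_simps power2_eq_square)
    finally show ?thesis .
  qed
  ultimately show ?thesis
    by (intro exI[of _ G] exI[of _ G'])
       (simp add: has_first_second_deriv_on_def G'_def s_def)
qed

text \<open>Cosine is strictly decreasing on \<open>[0, pi]\<close>, which contains both
  \<open>sqrt k * x\<close> and the \<open>arccos\<close> value, so passing to cosines reverses the
  order.\<close>

lemma gk_compare_iff:
  assumes k: "0 < k" and uv: "u\<^sup>2 + v\<^sup>2 < 1 / k" and x: "0 \<le> x" "x \<le> pi / sqrt k"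
  shows "x \<le> gk k u v t \<longleftrightarrow> cos_gk k u v t \<le> cos (sqrt k * x)"
    and "gk k u v t \<le> x \<longleftrightarrow> cos (sqrt k * x) \<le> cos_gk k u v t"
proof -
  have s: "sqrt k > 0" using k by simp
  have sx: "0 \<le> sqrt k * x" "sqrt k * x \<le> pi" using x s by (simp_all add: field_simps)
  let ?h = "cos_gk k u v t"
  have h: "\<bar>?h\<bar> \<le> 1" using abs_cos_gk_less_1[OF k uv, of t] by simp
  then have arc: "0 \<le> arccos ?h" "arccos ?h \<le> pi" "cos (arccos ?h) = ?h"
    by (auto simp: abs_le_iff arccos_lbound arccos_ubound)
  have "x \<le> gk k u v t \<longleftrightarrow> sqrt k * x \<le> arccos ?h"
    using s by (simp add: gk_conv_cos_gk field_simps)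
  also have "\<dots> \<longleftrightarrow> ?h \<le> cos (sqrt k * x)"
    using cos_mono_le_eq[OF arc(1,2) sx] arc(3) by simp
  finally show "x \<le> gk k u v t \<longleftrightarrow> ?h \<le> cos (sqrt k * x)" .
  have "gk k u v t \<le> x \<longleftrightarrow> arccos ?h \<le> sqrt k * x"
    using s by (simp add: gk_conv_cos_gk field_simps)
  also have "\<dots> \<longleftrightarrow> cos (sqrt k * x) \<le> ?h"
    using cos_mono_le_eq[OF sx arc(1,2)] arc(3) by simp
  finally show "gk k u v t \<le> x \<longleftrightarrow> cos (sqrt k * x) \<le> ?h" .
qed

section \<open>A maximum principle\<close>

text \<open>With \<open>c = cos (sqrt k * t)\<close>, the Wronskian
  \<open>W = c * w' - c' * w\<close> has derivative \<open>c * (w'' + k * w) \<le> 0\<close>, and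
  \<open>w / c\<close> has derivative \<open>W / c^2\<close>. A negative value of
  \<open>w / c\<close> between its zeros at \<open>p\<close> and \<open>q\<close> would make
  \<open>W\<close> negative at one point and positive at a later one.\<close>

lemma maximum_principle:
  fixes w w' w'' :: "real \<Rightarrow> real"
  assumes k: "0 \<le> k"
    and w: "has_first_second_deriv_on w w' w'' {p..q}"
    and zero: "w p = 0" "w q = 0"
    and c: "\<And>t. t \<in> {p..q} \<Longrightarrow> 0 < cos (sqrt k * t)"
    and le: "\<And>t. t \<in> {p..q} \<Longrightarrow> w'' t + k * w t \<le> 0"
    and t: "t \<in> {p..q}"
  shows "0 \<le> w t"
proof (rule ccontr)
  assume neg: "\<not> 0 \<le> w t"
  then have t': "p < t" "t < q" using t zero by (auto simp: order_less_le)
  define s where "s = sqrt k"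
  have ss: "s * s = k" using k by (simp add: s_def)
  have dw: "(w has_real_derivative w' x) (at x within {p..q})"
      "(w' has_real_derivative w'' x) (at x within {p..q})" if "x \<in> {p..q}" for x
    using w that by (auto simp: has_first_second_deriv_on_def)
  have c: "0 < cos (s * x)" if "x \<in> {p..q}" for x using c[OF that] by (simp add: s_def)
  define \<phi> where "\<phi> x = w x / cos (s * x)" for x
  define W where "W x = cos (s * x) * w' x + s * sin (s * x) * w x" for x
  have d\<phi>: "(\<phi> has_real_derivative W x / (cos (s * x))\<^sup>2) (at x within {p..q})"
    if "x \<in> {p..q}" for x
    unfolding \<phi>_def[abs_def] W_def using c[OF that]
    by (auto intro!: derivative_eq_intros dw that simp: field_simps power2_eq_square)
  have dW: "(W has_real_derivative cos (s * x) * (w'' x + k * w x)) (at x within {p..q})"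
    if "x \<in> {p..q}" for x
    unfolding W_def[abs_def] ss[symmetric]
    by (auto intro!: derivative_eq_intros dw that simp: algebra_simps)
  \<comment> \<open>The mean value theorem for derivatives within \<open>{p..q}\<close>, which are
    two-sided at interior points.\<close>
  have mean: "\<exists>z\<in>{x<..<y}. f y - f x = (y - x) * f' z"
    if f: "\<And>z. z \<in> {p..q} \<Longrightarrow> (f has_real_derivative f' z) (at z within {p..q})"
      and xy: "p \<le> x" "x < y" "y \<le> q" for f f' :: "real \<Rightarrow> real" and x y
  proof -
    have "continuous_on {x..y} f"
      using xy DERIV_continuous_on[of "{p..q}" f f'] f
      by (auto intro: continuous_on_subset)
    moreover have "(f has_derivative (*) (f' z)) (at z)" if "x < z" "z < y" for z
    proof -
      have "at z within {p..q} = at z"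
        using that xy by (intro at_within_interior) (auto simp: interior_cbox)
      then show ?thesis
        using f[of z] that xy by (simp add: has_field_derivative_def)
    qed
    ultimately obtain z where "x < z" "z < y" "f y - f x = f' z * (y - x)"
      using mvt[OF xy(2), of f "\<lambda>z. (*) (f' z)"] by blast
    then show ?thesis by (auto simp: mult.commute)
  qed
  have \<phi>: "\<phi> p = 0" "\<phi> q = 0" "\<phi> t < 0"
    using neg zero c[OF t] by (auto simp: \<phi>_def divide_neg_pos)
  obtain x where x: "p < x" "x < t" "\<phi> t - \<phi> p = (t - p) * (W x / (cos (s * x))\<^sup>2)"
    using mean[OF d\<phi>, of p t] t' by auto
  obtain y where y: "t < y" "y < q" "\<phi> q - \<phi> t = (q - t) * (W y / (cos (s * y))\<^sup>2)"
    using mean[OF d\<phi>, of t q] t' by auto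
  have "(t - p) * (W x / (cos (s * x))\<^sup>2) < 0" "0 < (q - t) * (W y / (cos (s * y))\<^sup>2)"
    using x(3) y(3) \<phi> by linarith+
  then have "W x < 0" "0 < W y"
    using t' by (auto simp: mult_less_0_iff zero_less_mult_iff divide_less_0_iff
        zero_less_divide_iff not_less)
  moreover obtain z where "x < z" "z < y" "W y - W x = (y - x) * (cos (s * z) * (w'' z + k * w z))"
    using mean[OF dW, of x y] x y by auto
  moreover from this have "(y - x) * (cos (s * z) * (w'' z + k * w z)) \<le> 0"
    using c[of z] le[of z] x y by (intro mult_nonneg_nonpos) auto
  ultimately show False by linarith
qed

text \<open>The weak principle gives \<open>w \<ge> 0\<close>. Were \<open>w\<close> nowhere
  positive, it would vanish identically, hence also \<open>w'' p\<close>, against the strict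
  inequality at \<open>p\<close>.\<close>

lemma strict_maximum_principle:
  fixes w w' w'' :: "real \<Rightarrow> real"
  assumes k: "0 \<le> k" and "p < q"
    and w: "has_first_second_deriv_on w w' w'' {p..q}"
    and zero: "w p = 0" "w q = 0"
    and c: "\<And>t. t \<in> {p..q} \<Longrightarrow> 0 < cos (sqrt k * t)"
    and less: "\<And>t. t \<in> {p..q} \<Longrightarrow> w'' t + k * w t < 0"
  shows "\<exists>t\<in>{p..q}. 0 < w t"
proof (rule ccontr)
  assume "\<not> (\<exists>t\<in>{p..q}. 0 < w t)"
  moreover have "0 \<le> w t" if "t \<in> {p..q}" for t
    using maximum_principle[OF k w zero c _ that] less by (simp add: less_imp_le)
  ultimately have w0: "w t = 0" if "t \<in> {p..q}" for t
    using that by (meson antisym not_less)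
  \<comment> \<open>Since \<open>p < q\<close>, even one-sided derivatives at the end points are
    unique.\<close>
  have uniq: "D = 0"
    if "(f has_real_derivative D) (at x within {p..q})" "x \<in> {p..q}" "\<And>y. y \<in> {p..q} \<Longrightarrow> f y = 0"
    for f :: "real \<Rightarrow> real" and D x
  proof -
    have "((\<lambda>_. 0) has_real_derivative D) (at x within {p..q})"
      by (rule has_field_derivative_transform_within[OF that(1) zero_less_one that(2)])
         (use that(3) in auto)
    then have "((\<lambda>_. 0) has_vector_derivative D) (at x within cbox p q)"
      by (simp add: has_real_derivative_iff_has_vector_derivative)
    from vector_derivative_unique_within_closed_interval[OF \<open>p < q\<close> _ this, of 0] that(2)
    show ?thesis by simp
  qed
  have "w' t = 0" if "t \<in> {p..q}" for t
    using uniq[of w "w' t" t] w0 w that by (auto simp: has_first_second_deriv_on_def)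
  then have "w'' p = 0"
    using uniq[of w' "w'' p" p] w \<open>p < q\<close> by (auto simp: has_first_second_deriv_on_def)
  then show False using less[of p] zero \<open>p < q\<close> by simp
qed

section \<open>Comparison of distance-like functions\<close>

locale spherical_distance_like =
  fixes k a b :: real and g g' g'' :: "real \<Rightarrow> real"
  assumes k: "0 < k"
    and ab: "a < b"
    and deriv: "has_first_second_deriv_on g g' g'' {a..b}"
    and cont: "continuous_on {a..b} g''"
    and pos: "\<And>t. t \<in> {a..b} \<Longrightarrow> 0 < g t"
    and dist_like: "distance_like_on a b g"
    and g_le: "\<And>t. t \<in> {a..b} \<Longrightarrow> g t \<le> pi / sqrt k"
    and cos_pos: "\<And>t. t \<in> {a..b} \<Longrightarrow> 0 < cos (sqrt k * t)"
    and sin_pos: "\<And>t. t \<in> {a..b} \<Longrightarrow> 0 < sin (sqrt k * g t)"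
begin

section \<open>Passage from \<open>g\<close> to a linear differential inequality\<close>

definition f where "f t = cos (sqrt k * g t)"
definition f' where "f' t = - sqrt k * sin (sqrt k * g t) * g' t"
definition f'' where
  "f'' t = - k * cos (sqrt k * g t) * (g' t)\<^sup>2 - sqrt k * sin (sqrt k * g t) * g'' t"

text \<open>The operator that annihilates every \<open>cos_gk\<close>; its value on \<open>f\<close>
  measures how far \<open>g\<close> is from solving the differential equation.\<close>

definition defect where "defect t = f'' t + k * f t"

lemma f_deriv: "has_first_second_deriv_on f f' f'' {a..b}"
proof -
  have ss: "sqrt k * (sqrt k * x) = k * x" for x
    using k by (simp add: mult.assoc[symmetric])
  show ?thesis
    using deriv
    unfolding has_first_second_deriv_on_def f_def[abs_def] f'_def[abs_def] f''_def
    by (auto intro!: derivative_eq_intros simp: algebra_simps power2_eq_square ss)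
qed

lemma continuous_on_defect: "continuous_on {a..b} defect"
proof -
  have "continuous_on {a..b} g"
    using deriv DERIV_continuous_on[of "{a..b}" g g'] by (simp add: has_first_second_deriv_on_def)
  moreover have "continuous_on {a..b} g'"
    using deriv DERIV_continuous_on[of "{a..b}" g' g''] by (simp add: has_first_second_deriv_on_def)
  ultimately show ?thesis
    using cont unfolding defect_def[abs_def] f_def f''_def by (intro continuous_intros)
qed

text \<open>The product of sine and cotangent is the cosine. The factor in front is positive, so the
  sign of \<open>defect\<close> decides the differential inequality.\<close>

lemma defect_eq:
  assumes "t \<in> {a..b}"
  shows "defect t = sqrt k * sin (sqrt k * g t) *
    (sqrt k * (1 - (g' t)\<^sup>2) * cot (sqrt k * g t) - g'' t)"
proof -
  let ?S = "sin (sqrt k * g t)"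
  have ss: "sqrt k * sqrt k = k" using k by simp
  have "?S * cot (sqrt k * g t) = cos (sqrt k * g t)"
    using sin_pos[OF assms] by (simp add: cot_def)
  then have "sqrt k * ?S * (sqrt k * (1 - (g' t)\<^sup>2) * cot (sqrt k * g t) - g'' t)
      = (sqrt k * sqrt k) * (1 - (g' t)\<^sup>2) * cos (sqrt k * g t) - sqrt k * ?S * g'' t"
    by (simp only: right_diff_distrib left_diff_distrib flip: \<open>?S * cot (sqrt k * g t) = _\<close>)
       (simp only: mult.assoc mult.commute mult.left_commute)
  then show ?thesis
    unfolding ss defect_def f_def f''_def by (simp add: algebra_simps)
qed

lemma defect_sign_iff:
  assumes "t \<in> {a..b}"
  shows "g'' t \<ge> sqrt k * (1 - (g' t)\<^sup>2) * cot (sqrt k * g t) \<longleftrightarrow> defect t \<le> 0"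
    and "g'' t \<le> sqrt k * (1 - (g' t)\<^sup>2) * cot (sqrt k * g t) \<longleftrightarrow> 0 \<le> defect t"
  unfolding defect_eq[OF assms] using sin_pos[OF assms] k
  by (auto simp: mult_le_0_iff zero_le_mult_iff)

lemma nonexpanding: "x \<in> {a..b} \<Longrightarrow> y \<in> {a..b} \<Longrightarrow> \<bar>g x - g y\<bar> \<le> \<bar>x - y\<bar>"
  using dist_like by (simp add: distance_like_on_def)

text \<open>At equality the sine in \<open>sin_pos\<close> would be
  \<open>sin pi = 0\<close>.\<close>

lemma g_less: "t \<in> {a..b} \<Longrightarrow> g t < pi / sqrt k"
  using g_le[of t] sin_pos[of t] k by (auto simp: order_less_le)

lemma compare_iff:
  assumes "t \<in> {a..b}" "u\<^sup>2 + v\<^sup>2 < 1 / k"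
  shows "g t \<le> gk k u v t \<longleftrightarrow> 0 \<le> f t - cos_gk k u v t"
    and "gk k u v t \<le> g t \<longleftrightarrow> 0 \<le> cos_gk k u v t - f t"
  using gk_compare_iff[OF k assms(2) _ g_le] pos assms(1)
  by (auto simp: f_def less_imp_le)

text \<open>The comparison function drops out of \<open>w'' + k * w\<close>, which leaves the defect
  of \<open>g\<close>. Both \<open>w\<close> and \<open>- w\<close> are covered because each
  equivalence applies a maximum principle to one sign and the strict one to the other.\<close>

lemma difference_props:
  assumes "a \<le> p" "q \<le> b" "p < q" "adjusted k g p q u v"
  defines "w \<equiv> \<lambda>t. f t - cos_gk k u v t"
    and "w' \<equiv> \<lambda>t. f' t - cos_gk_deriv k u v t"
    and "w'' \<equiv> \<lambda>t. f'' t + k * cos_gk k u v t"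
  shows "has_first_second_deriv_on w w' w'' {p..q}"
    and "has_first_second_deriv_on (\<lambda>t. - w t) (\<lambda>t. - w' t) (\<lambda>t. - w'' t) {p..q}"
    and "w p = 0" "w q = 0"
    and "w'' t + k * w t = defect t"
proof -
  have sub: "{p..q} \<subseteq> {a..b}" using assms by auto
  show *: "has_first_second_deriv_on w w' w'' {p..q}"
    unfolding has_first_second_deriv_on_def
  proof (intro ballI conjI)
    fix t assume t: "t \<in> {p..q}"
    have "(f has_real_derivative f' t) (at t within {p..q})"
      "(f' has_real_derivative f'' t) (at t within {p..q})"
      using f_deriv t sub has_field_derivative_subset[OF _ sub]
      by (auto simp: has_first_second_deriv_on_def)
    then show "(w has_real_derivative w' t) (at t within {p..q})"
      "(w' has_real_derivative w'' t) (at t within {p..q})"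
      unfolding w_def w'_def w''_def
      by (auto intro!: derivative_eq_intros cos_gk_has_derivs[OF k])
  qed
  then show "has_first_second_deriv_on (\<lambda>t. - w t) (\<lambda>t. - w' t) (\<lambda>t. - w'' t) {p..q}"
    by (auto simp: has_first_second_deriv_on_def intro!: DERIV_minus)
  have adj: "u\<^sup>2 + v\<^sup>2 < 1 / k" "gk k u v p = g p" "gk k u v q = g q"
    using assms(4) by (auto simp: adjusted_def)
  \<comment> \<open>Equality of distances is read as two inequalities, each carried over to
    cosines.\<close>
  show "w p = 0" "w q = 0"
    using compare_iff[OF _ adj(1), of p] compare_iff[OF _ adj(1), of q] adj assms(1-3)
    by (auto simp: w_def)
  show "w'' t + k * w t = defect t"
    by (simp add: w_def w''_def defect_def algebra_simps)
qed

section \<open>Nondegenerate triangles where the defect is nonzero\<close>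

text \<open>A nonexpanding function attaining the extreme difference over \<open>{p..q}\<close> is
  affine there with slope \<open>1\<close> or \<open>-1\<close>. Then \<open>g'' = 0\<close> and
  \<open>1 - (g')^2 = 0\<close> inside, so both terms of \<open>defect_eq\<close> vanish.\<close>

lemma slope_one_imp_defect_zero:
  assumes "a \<le> p" "q \<le> b" "p < q" and slope: "\<bar>g p - g q\<bar> = q - p"
  shows "\<exists>t\<in>{p..q}. defect t = 0"
proof -
  have near: "\<bar>g p - g t\<bar> \<le> t - p" "\<bar>g t - g q\<bar> \<le> q - t" if "t \<in> {p..q}" for t
    using nonexpanding[of p t] nonexpanding[of t q] that assms(1-3) by simp_all
  obtain \<sigma> :: real where \<sigma>: "\<sigma> * \<sigma> = 1" "\<And>t. t \<in> {p..q} \<Longrightarrow> g p + \<sigma> * (t - p) = g t"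
  proof (cases "g p \<le> g q")
    case True
    then have "g q - g p = q - p" using slope by linarith
    then have "g p + 1 * (t - p) = g t" if "t \<in> {p..q}" for t
      using near[OF that] unfolding mult_1 by linarith
    then show thesis using that[of 1] by simp
  next
    case False
    then have "g p - g q = q - p" using slope by linarith
    then have "g p + -1 * (t - p) = g t" if "t \<in> {p..q}" for t
      using near[OF that] unfolding mult_minus1 by linarith
    then show thesis using that[of "-1"] by simp
  qed
  \<comment> \<open>Any interior point would do: there the derivatives are two-sided and can be
    computed from the affine formula.\<close>
  define m where "m = (p + q) / 2"
  have m: "m \<in> {p<..<q}" using assms by (simp add: m_def)
  have at: "(g has_real_derivative g' t) (at t)" "(g' has_real_derivative g'' t) (at t)"
    if "t \<in> {p<..<q}" for t
  proof -
    have "at t within {a..b} = at t" "t \<in> {a..b}"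
      using that assms(1,2) by (auto intro!: at_within_interior)
    then show "(g has_real_derivative g' t) (at t)" "(g' has_real_derivative g'' t) (at t)"
      using deriv unfolding has_first_second_deriv_on_def by force+
  qed
  have g'\<sigma>: "g' t = \<sigma>" if "t \<in> {p<..<q}" for t
  proof -
    have "((\<lambda>t. g p + \<sigma> * (t - p)) has_real_derivative \<sigma>) (at t)"
      by (auto intro!: derivative_eq_intros)
    then have "(g has_real_derivative \<sigma>) (at t)"
      by (rule has_field_derivative_transform_within_open[of _ _ _ "{p<..<q}"])
         (use that \<sigma>(2) in auto)
    with at(1)[OF that] show ?thesis by (rule DERIV_unique)
  qed
  have "((\<lambda>_. \<sigma>) has_real_derivative 0) (at m)" by simp
  then have "(g' has_real_derivative 0) (at m)"
    by (rule has_field_derivative_transform_within_open[of _ _ _ "{p<..<q}"])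
       (use m g'\<sigma> in auto)
  with at(2)[OF m] have "g'' m = 0" by (rule DERIV_unique)
  moreover have "(g' m)\<^sup>2 = 1" using g'\<sigma>[OF m] \<sigma>(1) by (simp add: power2_eq_square)
  ultimately have "defect m = 0" using defect_eq[of m] m assms by simp
  then show ?thesis using m by (intro bexI[of _ m]) auto
qed

text \<open>By continuity the defect keeps its sign near \<open>t0\<close>. A short enough interval
  there spans a triangle with strict triangle inequalities and small perimeter, so
  \<open>adjusted_ex1\<close> applies.\<close>

lemma adjusted_near_nonzero_defect:
  assumes t0: "t0 \<in> {a..b}" and nz: "defect t0 \<noteq> 0"
  obtains p q u v where "a \<le> p" "p < q" "q \<le> b" "adjusted k g p q u v"
    "\<And>t. t \<in> {p..q} \<Longrightarrow> 0 < defect t0 * defect t"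
proof -
  \<comment> \<open>Multiplying by \<open>defect t0\<close> treats both signs at once.\<close>
  have "continuous_on {a..b} (\<lambda>t. defect t0 * defect t)"
    by (intro continuous_intros continuous_on_defect)
  moreover have "0 < defect t0 * defect t0"
    using nz by (metis not_square_less_zero linorder_neqE_linordered_idom mult_eq_0_iff)
  ultimately obtain d where "0 < d" and
    "\<forall>t\<in>{a..b}. dist t t0 < d \<longrightarrow>
      dist (defect t0 * defect t) (defect t0 * defect t0) < defect t0 * defect t0"
    using t0 unfolding continuous_on_iff by meson
  then have d: "0 < d" "\<And>t. t \<in> {a..b} \<Longrightarrow> \<bar>t - t0\<bar> < d \<Longrightarrow> 0 < defect t0 * defect t"
    by (force simp: dist_real_def abs_less_iff)+
  \<comment> \<open>Starting to the left of \<open>t0\<close>, where possible, leaves room for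
    \<open>q > p\<close> even if \<open>t0 = b\<close>.\<close>
  define p where "p = max a (t0 - d / 2)"
  have p: "a \<le> p" "p < b" "t0 - d / 2 \<le> p" "p \<le> t0"
    using t0 d(1) ab by (auto simp: p_def)
  define K where "K = pi / sqrt k"
  \<comment> \<open>The three bounds serve, in order, to stay within \<open>d\<close> of
    \<open>t0\<close>, to get \<open>q - p < g p + g q\<close>, and to bound the perimeter; halving
    makes the last two strict.\<close>
  define e where "e = min (min d (g p)) (K - g p) / 2"
  have gp: "0 < g p" "g p < K" using pos[of p] g_less[of p] p by (auto simp: K_def)
  have "e \<le> g p / 2" "e \<le> (K - g p) / 2" and e: "0 < e" "e \<le> d / 2"
    using gp d(1) by (auto simp: e_def min_def)
  then have e': "e < g p" "e < K - g p" using gp by simp_all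
  define q where "q = min b (p + e)"
  have q: "p < q" "q \<le> b" "q - p \<le> e" using p e by (auto simp: q_def)
  have "q - p \<le> d / 2" using q(3) e(2) by simp
  have near: "0 < defect t0 * defect t" if "t \<in> {p..q}" for t
    using that p q \<open>q - p \<le> d / 2\<close> d(1) by (intro d(2)) auto
  have pq: "p \<in> {a..b}" "q \<in> {a..b}" using p q by auto
  have lip: "\<bar>g p - g q\<bar> \<le> q - p"
    using nonexpanding[OF pq] q(1) by simp
  have "\<exists>!(u, v). adjusted k g p q u v"
  proof (rule adjusted_ex1[OF k])
    \<comment> \<open>Equality would produce a zero of the defect in \<open>{p..q}\<close>, where it
      has a fixed sign.\<close>
    have "\<bar>g p - g q\<bar> \<noteq> q - p"
      using slope_one_imp_defect_zero[OF p(1) q(2,1)] near by fastforce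
    with lip show "\<bar>g p - g q\<bar> < q - p" by simp
    show "q - p < g p + g q" using e' q(3) pos[OF pq(2)] by linarith
    \<comment> \<open>As \<open>g q \<le> g p + (q - p)\<close>, the perimeter is at most
      \<open>2 * (g p + e)\<close>.\<close>
    have "g p + g q + (q - p) < 2 * K" using lip e' q(3) by linarith
    then show "g p + g q + (q - p) < 2 * pi / sqrt k" by (simp add: K_def)
  qed
  then obtain u v where "adjusted k g p q u v" by auto
  with that p(1) q(1,2) near show thesis by blast
qed

section \<open>Sign of the defect and comparison on subintervals\<close>

text \<open>Forward, the maximum principle for \<open>w = f - cos_gk\<close> gives larger cosines,
  hence smaller distances. Backward, a positive defect yields an interval on which the strict
  principle for \<open>- w\<close> contradicts the comparison.\<close>

lemma defect_nonpos_iff: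
  "(\<forall>t\<in>{a..b}. defect t \<le> 0) \<longleftrightarrow>
   (\<forall>p q u v. a \<le> p \<and> p < q \<and> q \<le> b \<and> adjusted k g p q u v \<longrightarrow>
      (\<forall>t\<in>{p..q}. g t \<le> gk k u v t))"
proof (intro iffI allI impI ballI)
  fix p q u v t
  assume D: "\<forall>t\<in>{a..b}. defect t \<le> 0" and t: "t \<in> {p..q}"
    and "a \<le> p \<and> p < q \<and> q \<le> b \<and> adjusted k g p q u v"
  then have pq: "a \<le> p" "p < q" "q \<le> b" and adj: "adjusted k g p q u v" by auto
  note w = difference_props[OF pq(1,3,2) adj]
  have "0 \<le> f t - cos_gk k u v t"
    by (rule maximum_principle[OF _ w(1,3,4) cos_pos _ t])
       (use k D pq w(5) in auto)
  then show "g t \<le> gk k u v t"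
    using compare_iff(1)[of t u v] adj t pq by (simp add: adjusted_def)
next
  fix t0
  assume *: "\<forall>p q u v. a \<le> p \<and> p < q \<and> q \<le> b \<and> adjusted k g p q u v \<longrightarrow>
      (\<forall>t\<in>{p..q}. g t \<le> gk k u v t)" and t0: "t0 \<in> {a..b}"
  show "defect t0 \<le> 0"
  proof (rule ccontr)
    assume neg: "\<not> defect t0 \<le> 0"
    then obtain p q u v where pq: "a \<le> p" "p < q" "q \<le> b" and adj: "adjusted k g p q u v"
      and D: "\<And>t. t \<in> {p..q} \<Longrightarrow> 0 < defect t0 * defect t"
      using adjusted_near_nonzero_defect[OF t0] by (metis order_refl)
    note w = difference_props[OF pq(1,3,2) adj]
    have "\<exists>t\<in>{p..q}. 0 < - (f t - cos_gk k u v t)"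
    proof (rule strict_maximum_principle[OF _ pq(2) w(2) _ _ cos_pos])
      fix t assume "t \<in> {p..q}"
      then have "0 < defect t" using D[of t] neg by (simp add: zero_less_mult_iff)
      then show "- (f'' t + k * cos_gk k u v t) + k * - (f t - cos_gk k u v t) < 0"
        using w(5)[of t] by (simp add: algebra_simps)
    qed (use k pq w(3,4) in auto)
    then obtain t where t: "t \<in> {p..q}" "f t - cos_gk k u v t < 0" by auto
    moreover have "g t \<le> gk k u v t" using * pq adj t(1) by blast
    ultimately show False
      using compare_iff(1)[of t u v] adj pq by (simp add: adjusted_def)
  qed
qed

text \<open>The argument of \<open>defect_nonpos_iff\<close> with the roles of \<open>w\<close> and
  \<open>- w\<close> exchanged.\<close>

lemma defect_nonneg_iff:
  "(\<forall>t\<in>{a..b}. 0 \<le> defect t) \<longleftrightarrow>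
   (\<forall>p q u v. a \<le> p \<and> p < q \<and> q \<le> b \<and> adjusted k g p q u v \<longrightarrow>
      (\<forall>t\<in>{p..q}. gk k u v t \<le> g t))"
proof (intro iffI allI impI ballI)
  fix p q u v t
  assume D: "\<forall>t\<in>{a..b}. 0 \<le> defect t" and t: "t \<in> {p..q}"
    and "a \<le> p \<and> p < q \<and> q \<le> b \<and> adjusted k g p q u v"
  then have pq: "a \<le> p" "p < q" "q \<le> b" and adj: "adjusted k g p q u v" by auto
  note w = difference_props[OF pq(1,3,2) adj]
  have "0 \<le> - (f t - cos_gk k u v t)"
  proof (rule maximum_principle[OF _ w(2) _ _ cos_pos _ t])
    fix t assume "t \<in> {p..q}"
    then have "0 \<le> defect t" using D pq by auto
    then show "- (f'' t + k * cos_gk k u v t) + k * - (f t - cos_gk k u v t) \<le> 0"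
      using w(5)[of t] by (simp add: algebra_simps)
  qed (use k pq w(3,4) in auto)
  then show "gk k u v t \<le> g t"
    using compare_iff(2)[of t u v] adj t pq by (simp add: adjusted_def)
next
  fix t0
  assume *: "\<forall>p q u v. a \<le> p \<and> p < q \<and> q \<le> b \<and> adjusted k g p q u v \<longrightarrow>
      (\<forall>t\<in>{p..q}. gk k u v t \<le> g t)" and t0: "t0 \<in> {a..b}"
  show "0 \<le> defect t0"
  proof (rule ccontr)
    assume neg: "\<not> 0 \<le> defect t0"
    then obtain p q u v where pq: "a \<le> p" "p < q" "q \<le> b" and adj: "adjusted k g p q u v"
      and D: "\<And>t. t \<in> {p..q} \<Longrightarrow> 0 < defect t0 * defect t"
      using adjusted_near_nonzero_defect[OF t0] by (metis order_refl)
    note w = difference_props[OF pq(1,3,2) adj]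
    have "\<exists>t\<in>{p..q}. 0 < f t - cos_gk k u v t"
    proof (rule strict_maximum_principle[OF _ pq(2) w(1) w(3,4) cos_pos])
      fix t assume "t \<in> {p..q}"
      then have "defect t < 0" using D[of t] neg by (simp add: zero_less_mult_iff)
      then show "f'' t + k * cos_gk k u v t + k * (f t - cos_gk k u v t) < 0"
        using w(5)[of t] by simp
    qed (use k pq in auto)
    then obtain t where t: "t \<in> {p..q}" "0 < f t - cos_gk k u v t" by auto
    moreover have "gk k u v t \<le> g t" using * pq adj t(1) by blast
    ultimately show False
      using compare_iff(2)[of t u v] adj pq by (simp add: adjusted_def)
  qed
qed

lemma comparison:
  "(\<forall>t\<in>{a..b}. g'' t \<ge> sqrt k * (1 - (g' t)\<^sup>2) * cot (sqrt k * g t)) \<longleftrightarrow>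
   (\<forall>p q u v. a \<le> p \<and> p < q \<and> q \<le> b \<and> adjusted k g p q u v \<longrightarrow>
      (\<forall>t\<in>{p..q}. g t \<le> gk k u v t))"
  "(\<forall>t\<in>{a..b}. g'' t \<le> sqrt k * (1 - (g' t)\<^sup>2) * cot (sqrt k * g t)) \<longleftrightarrow>
   (\<forall>p q u v. a \<le> p \<and> p < q \<and> q \<le> b \<and> adjusted k g p q u v \<longrightarrow>
      (\<forall>t\<in>{p..q}. g t \<ge> gk k u v t))"
  unfolding defect_nonpos_iff[symmetric] defect_nonneg_iff[symmetric]
  by (simp_all add: defect_sign_iff)

end

section \<open>Reduction of the theorem to the comparison locale\<close>

theorem proposition2p3:
  fixes k :: real
  assumes "k > 0"
  shows
    "(\<forall>u v. u\<^sup>2 + v\<^sup>2 < 1 / k \<longrightarrow>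
        (\<exists>gk' gk''. has_first_second_deriv_on (gk k u v) gk' gk'' UNIV \<and>
          (\<forall>t. gk'' t = sqrt k * (1 - (gk' t)\<^sup>2) * cot (sqrt k * gk k u v t))))
     \<and>
     (\<forall>a b g g' g''.
        0 \<le> a \<and> a < b \<and>
        has_first_second_deriv_on g g' g'' {a..b} \<and> continuous_on {a..b} g'' \<and>
        (\<forall>t\<in>{a..b}. 0 < g t) \<and>
        distance_like_on a b g \<and>
        (\<forall>t1 t2. a \<le> t1 \<and> t1 < t2 \<and> t2 \<le> b \<longrightarrow>
           triangle_embeddable k (t2 - t1) (g t1) (g t2)) \<and>
        (\<forall>t\<in>{a..b}. 0 < cos (sqrt k * t) \<and> 0 < sin (sqrt k * g t))
        \<longrightarrow>
        ((\<forall>t\<in>{a..b}. g'' t \<ge> sqrt k * (1 - (g' t)\<^sup>2) * cot (sqrt k * g t)) \<longleftrightarrow>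
         (\<forall>t1 t2 u v. a \<le> t1 \<and> t1 < t2 \<and> t2 \<le> b \<and> adjusted k g t1 t2 u v \<longrightarrow>
            (\<forall>t\<in>{t1..t2}. g t \<le> gk k u v t)))
        \<and>
        ((\<forall>t\<in>{a..b}. g'' t \<le> sqrt k * (1 - (g' t)\<^sup>2) * cot (sqrt k * g t)) \<longleftrightarrow>
         (\<forall>t1 t2 u v. a \<le> t1 \<and> t1 < t2 \<and> t2 \<le> b \<and> adjusted k g t1 t2 u v \<longrightarrow>
            (\<forall>t\<in>{t1..t2}. g t \<ge> gk k u v t))))"
proof (rule conjI, goal_cases)
  case 1
  then show ?case using gk_differential_equation[OF assms] by blast
next
  case 2
  show ?case
  proof (intro allI impI, goal_cases)
    case (1 a b g g' g'')
    \<comment> \<open>Every \<open>t < b\<close> is the left end of a triangle reaching to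
      \<open>b\<close>; the remaining point \<open>b\<close> is the right end of one starting at
      \<open>a\<close>.\<close>
    have "g t \<le> pi / sqrt k" if "t \<in> {a..b}" for t
    proof (cases "t < b")
      case True
      then have "triangle_embeddable k (b - t) (g t) (g b)" using 1 that by auto
      then show ?thesis using triangle_embeddable_le(1)[OF assms] by blast
    next
      case False
      then have "triangle_embeddable k (t - a) (g a) (g t)" using 1 that by auto
      then show ?thesis using triangle_embeddable_le(2)[OF assms] by blast
    qed
    then interpret spherical_distance_like k a b g g' g''
      using 1 assms by unfold_locales auto
    show ?case by (intro conjI comparison)
  qed
qed

end
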